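(* Let $A \in \mathbf{R}^{n\times n}$ be an invertible matrix (the dynamics matrix of a network), let $\mathcal{B} = \{e_1,\dots,e_n\}$ be the set of canonical unit vectors of $\mathbf{R}^n$, let $S \subset \mathcal{B}$ be a nonempty input set, let $B_S \in \mathbf{R}^{n\times |S|}$ be the matrix whose columns are the elements of $S$, and let the input cost matrix be $R_S = I$. Suppose that $A$ is Schur unstable, with $|\lambda_{max}(A)| > 1$, where $\lambda_{max}(A)$ denotes the eigenvalue of $A$ of maximum magnitude. Suppose further that $A$ is diagonalizable by the eigenvector matrix $V$ (i.e. $V$ is invertible, possibly complex, and $V^{-1}AV$ is diagonal). For any $\eta \in (1, |\lambda_{max}(A)|]$ define $$\bar n = |\{\lambda : \lambda \in \mathrm{spec}(A),\ |\lambda| \geq \eta\}|.$$ Then for all $\eta \in (1, |\lambda_{max}(A)|]$ and for any symmetric $Q \succeq 0$ such that $(A, Q^{1/2})$ is detectable, it holds that $$\lambda_{max}(P) \;\geq\; \mathrm{cond}^{-2}(V)\, \frac{\eta^2-1}{\eta^2}\, \eta^{2\left(\frac{\bar n}{|S|}-1\right)},$$ where $P \succeq 0$ is the optimal closed-loop (infinite-horizon) cost matrix, satisfying the algebraic Riccati equation $$P = Q + A^T P A - A^T P B_S (R_S + B_S^T P B_S)^{-1} B_S^T P A .$$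
   Context: The network dynamics are the discrete-time linear system $x_{t+1} = A x_t + B_S u_t$ with $x_t\in\mathbf{R}^n$, $u_t \in \mathbf{R}^{|S|}$. The infinite-horizon linear quadratic regulator cost is $\sum_{t\ge 0} (x_t^T Q x_t + u_t^T R_S u_t)$, and the optimal cost from $x_0$ is $x_0^T P x_0$, where $P$ is the positive semidefinite solution of the algebraic Riccati equation displayed in the claim. $P$ is symmetric positive semidefinite and $\lambda_{max}(P)$ is its largest eigenvalue. $\mathrm{cond}(V)$ is the condition number of $V$, i.e. the ratio of its largest to its smallest singular value. $\mathrm{spec}(A)$ denotes the spectrum of $A$. *)

theory Defs
  imports "HOL-Analysis.Analysis"
begin

definition eigenvalues :: "'a::field^'n^'n \<Rightarrow> 'a set" where
  "eigenvalues M = {c. \<exists>v. v \<noteq> 0 \<and> M *v v = c *s v}"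

abbreviation complex_matrix :: "real^'m^'n \<Rightarrow> complex^'m^'n" where
  "complex_matrix \<equiv> map_matrix complex_of_real"

text \<open>The spectrum of a real matrix is a set of complex numbers: an eigenvalue is listed once,
  whatever its multiplicity.\<close>

definition spec :: "real^'n^'n \<Rightarrow> complex set" where
  "spec A = eigenvalues (complex_matrix A)"

text \<open>The two readings of \<open>\<lambda>_max\<close>: for a general square matrix an eigenvalue of maximum
  magnitude (unique only up to its magnitude), for a symmetric matrix the largest eigenvalue.\<close>

definition dominant_eigenvalue :: "real^'n^'n \<Rightarrow> complex" where
  "dominant_eigenvalue A = (ARG_MAX cmod \<mu>. \<mu> \<in> spec A)"

definition lambda_max :: "real^'n^'n \<Rightarrow> real" where
  "lambda_max P = Max (eigenvalues P)"

definition schur_stable :: "real^'n^'n \<Rightarrow> bool" where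
  "schur_stable M \<longleftrightarrow> (\<forall>\<mu>\<in>spec M. cmod \<mu> < 1)"

definition detectable :: "real^'n^'n \<Rightarrow> real^'n^'p \<Rightarrow> bool" where
  "detectable A C \<longleftrightarrow> (\<exists>L :: real^'p^'n. schur_stable (A - L ** C))"

definition sym_psd :: "real^'n^'n \<Rightarrow> bool" where
  "sym_psd M \<longleftrightarrow> transpose M = M \<and> (\<forall>x. 0 \<le> x \<bullet> (M *v x))"

text \<open>\<open>H\<close> is the (unique) symmetric positive semidefinite square root of \<open>M\<close>.\<close>

definition is_psd_sqrt :: "real^'n^'n \<Rightarrow> real^'n^'n \<Rightarrow> bool" where
  "is_psd_sqrt H M \<longleftrightarrow> sym_psd H \<and> H ** H = M"

definition conj_transpose :: "complex^'m^'n \<Rightarrow> complex^'n^'m" where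
  "conj_transpose M = map_matrix cnj (transpose M)"

definition singular_values :: "complex^'n^'n \<Rightarrow> real set" where
  "singular_values M =
     {s. 0 \<le> s \<and> complex_of_real (s\<^sup>2) \<in> eigenvalues (conj_transpose M ** M)}"

definition cond :: "complex^'n^'n \<Rightarrow> real" where
  "cond M = Max (singular_values M) / Min (singular_values M)"

definition diagonal_matrix :: "'a::zero^'n^'n \<Rightarrow> bool" where
  "diagonal_matrix D \<longleftrightarrow> (\<forall>i j. i \<noteq> j \<longrightarrow> D $ i $ j = 0)"

definition diagonalized_by :: "real^'n^'n \<Rightarrow> complex^'n^'n \<Rightarrow> bool" where
  "diagonalized_by A V \<longleftrightarrow>
     invertible V \<and> diagonal_matrix (matrix_inv V ** complex_matrix A ** V)"

text \<open>\<open>B\<close> has exactly the elements of \<open>S\<close> as its columns, each once; their order is left open.\<close>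

definition input_matrix :: "(real^'n) set \<Rightarrow> real^'s^'n \<Rightarrow> bool" where
  "input_matrix S B \<longleftrightarrow> CARD('s) = card S \<and> columns B = S"

primrec trajectory ::
  "real^'n^'n \<Rightarrow> real^'s^'n \<Rightarrow> real^'n \<Rightarrow> (nat \<Rightarrow> real^'s) \<Rightarrow> nat \<Rightarrow> real^'n" where
  "trajectory A B x0 u 0 = x0"
| "trajectory A B x0 u (Suc t) = A *v trajectory A B x0 u t + B *v u t"

text \<open>The cost may be infinite. The stage cost is nonnegative whenever \<open>Q\<close> and \<open>R\<close> are positive
  semidefinite, so that the truncation in \<open>ennreal\<close> has no effect.\<close>

definition lqr_cost ::
  "real^'n^'n \<Rightarrow> real^'s^'n \<Rightarrow> real^'n^'n \<Rightarrow> real^'s^'s \<Rightarrow> real^'n \<Rightarrow> (nat \<Rightarrow> real^'s) \<Rightarrow> ennreal"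
  where
  "lqr_cost A B Q R x0 u =
     (\<Sum>t. ennreal (trajectory A B x0 u t \<bullet> (Q *v trajectory A B x0 u t) + u t \<bullet> (R *v u t)))"

definition optimal_cost_matrix ::
  "real^'n^'n \<Rightarrow> real^'s^'n \<Rightarrow> real^'n^'n \<Rightarrow> real^'s^'s \<Rightarrow> real^'n^'n \<Rightarrow> bool" where
  "optimal_cost_matrix A B Q R P \<longleftrightarrow>
     sym_psd P \<and> (\<forall>x0. ennreal (x0 \<bullet> (P *v x0)) = (INF u. lqr_cost A B Q R x0 u))"

definition riccati_equation ::
  "real^'n^'n \<Rightarrow> real^'s^'n \<Rightarrow> real^'n^'n \<Rightarrow> real^'s^'s \<Rightarrow> real^'n^'n \<Rightarrow> bool" where
  "riccati_equation A B Q R P \<longleftrightarrow>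
     P = Q + transpose A ** P ** A
       - transpose A ** P ** B ** matrix_inv (R + transpose B ** P ** B) ** transpose B ** P ** A"

definition num_eigenvalues_ge :: "real^'n^'n \<Rightarrow> real \<Rightarrow> nat" where
  "num_eigenvalues_ge A \<eta> = card {\<mu> \<in> spec A. \<eta> \<le> cmod \<mu>}"

end

theory Submission
  imports Defs
begin

text \<open>Let \<open>W = V\<^sup>-\<^sup>1\<close> and let \<open>I\<close> be the set of modes \<open>i\<close> with \<open>\<bar>\<lambda>\<^sub>i\<bar> \<ge> \<eta>\<close>. An input of finite cost keeps the
  modes in \<open>I\<close> bounded by detectability, so solving their recurrences backwards in time gives
  \<open>(W x\<^sub>0)\<^sub>i = - (\<Sum>s. \<lambda>\<^sub>i powi - (s + 1) * (W B u\<^sub>s)\<^sub>i)\<close>. If \<open>T * \<bar>S\<bar> < \<bar>I\<bar>\<close>, some \<open>y \<noteq> 0\<close> supported on \<open>I\<close> is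
  orthogonal to everything the inputs at times \<open>s < T\<close> contribute to the right-hand side. Paired
  with \<open>y\<close>, only times \<open>s \<ge> T\<close> remain, and Cauchy-Schwarz bounds the input energy needed from
  \<open>x\<^sub>0 = W\<^sup>* y\<close> below by a multiple of \<open>\<eta> ^ (2 * T)\<close>. This energy is at most the optimal cost, and
  hence at most \<open>\<lambda>\<^sub>m\<^sub>a\<^sub>x(P) * (norm x\<^sub>0)\<^sup>2\<close>. The theorem is the case \<open>T = (k - 1) div \<bar>S\<bar>\<close>, where \<open>k\<close> is the number of
  eigenvalues of modulus at least \<open>\<eta>\<close>.\<close>

subsection \<open>Self-adjoint maps and singular values\<close>

text \<open>Eigenvectors for distinct eigenvalues are orthogonal, and a Euclidean space holds only
  finitely many pairwise orthogonal vectors. Finiteness makes the \<open>Max\<close> and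
  \<open>Min\<close> in \<open>lambda_max\<close> and \<open>cond\<close> meaningful.\<close>

lemma selfadjoint_finite_eigenvalues:
  fixes f :: "'a::euclidean_space \<Rightarrow> 'a"
  assumes sa: "\<And>x y. f x \<bullet> y = x \<bullet> f y"
  shows "finite {c. \<exists>v. v \<noteq> 0 \<and> f v = c *\<^sub>R v}" (is "finite ?E")
proof -
  obtain v where v: "\<And>c. c \<in> ?E \<Longrightarrow> v c \<noteq> 0 \<and> f (v c) = c *\<^sub>R v c"
    using bchoice[of ?E "\<lambda>c v. v \<noteq> 0 \<and> f v = c *\<^sub>R v"] by blast
  have orth: "v c \<bullet> v d = 0" if "c \<in> ?E" "d \<in> ?E" "c \<noteq> d" for c d
  proof -
    have "c * (v c \<bullet> v d) = d * (v c \<bullet> v d)"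
      using sa[of "v c" "v d"] v[OF that(1)] v[OF that(2)] by simp
    then show ?thesis using that(3) by simp
  qed
  have "inj_on v ?E"
  proof (rule inj_onI, rule ccontr)
    fix c d assume "c \<in> ?E" "d \<in> ?E" "v c = v d" "c \<noteq> d"
    then have "v c \<bullet> v c = 0" using orth[of c d] by simp
    with v[OF \<open>c \<in> ?E\<close>] show False by simp
  qed
  moreover have "finite (v ` ?E)"
    by (rule pairwise_orthogonal_imp_finite)
      (use orth in \<open>force simp: pairwise_def orthogonal_def simp del: mem_Collect_eq\<close>)
  ultimately show ?thesis by (rule finite_imageD[rotated])
qed

text \<open>Rayleigh quotient: by compactness \<open>x \<bullet> f x\<close> attains a maximum on
  the unit sphere, and a maximiser is an eigenvector for that maximum.\<close>

lemma selfadjoint_max_eigenvalue: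
  fixes f :: "'a::euclidean_space \<Rightarrow> 'a"
  assumes lin: "linear f" and sa: "\<And>x y. f x \<bullet> y = x \<bullet> f y"
  obtains c v where "v \<noteq> 0" "f v = c *\<^sub>R v" "\<And>x. x \<bullet> f x \<le> c * (norm x)\<^sup>2"
proof -
  have cont: "continuous_on (sphere 0 1) (\<lambda>x. x \<bullet> f x)"
    by (intro continuous_on_inner continuous_on_id linear_continuous_on linear_conv_bounded_linear[THEN iffD1] lin)
  have ne: "sphere (0::'a) 1 \<noteq> {}" by simp
  obtain v where v: "norm v = 1" "\<And>x. norm x = 1 \<Longrightarrow> x \<bullet> f x \<le> v \<bullet> f v"
    using continuous_attains_sup[OF compact_sphere ne cont] by auto
  define c where "c = v \<bullet> f v"
  have le: "x \<bullet> f x \<le> c * (norm x)\<^sup>2" for x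
  proof (cases "x = 0")
    case False
    have "(x /\<^sub>R norm x) \<bullet> f (x /\<^sub>R norm x) \<le> c"
      unfolding c_def by (rule v(2)) (simp add: False)
    then have "(x \<bullet> f x) / (norm x)\<^sup>2 \<le> c"
      by (simp add: linear_cmul[OF lin] power2_eq_square divide_inverse mult_ac)
    then show ?thesis using False by (simp add: divide_le_eq)
  qed (simp add: linear_0[OF lin])
  define w where "w = c *\<^sub>R v - f v"
  define b where "b = c * (norm w)\<^sup>2 - w \<bullet> f w"
  define s where "s = (norm w)\<^sup>2"
  have b: "b \<ge> 0" using le[of w] by (simp add: b_def)
  \<comment> \<open>\<open>x \<mapsto> c * (norm x)\<^sup>2 - x \<bullet> f x\<close> is nonnegative and vanishes at \<open>v\<close>, so its
    derivative at \<open>v\<close> in direction \<open>w\<close>, which is \<open>2 * (norm w)\<^sup>2\<close>, must vanish.\<close>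
  have "0 \<le> 2 * t * s + t\<^sup>2 * b" for t
  proof -
    have vfw: "v \<bullet> f w = w \<bullet> f v" using sa[of v w] by (simp add: inner_commute)
    have 1: "(v + t *\<^sub>R w) \<bullet> (v + t *\<^sub>R w) = v \<bullet> v + 2 * t * (w \<bullet> v) + t\<^sup>2 * (w \<bullet> w)"
      by (simp add: inner_add_left inner_add_right inner_commute[of v w] power2_eq_square distrib_left)
    have 2: "(v + t *\<^sub>R w) \<bullet> f (v + t *\<^sub>R w) = v \<bullet> f v + 2 * t * (w \<bullet> f v) + t\<^sup>2 * (w \<bullet> f w)"
      by (simp add: linear_add[OF lin] linear_cmul[OF lin] inner_add_left inner_add_right vfw power2_eq_square distrib_left)
    have "0 \<le> c * ((v + t *\<^sub>R w) \<bullet> (v + t *\<^sub>R w)) - (v + t *\<^sub>R w) \<bullet> f (v + t *\<^sub>R w)"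
      using le[of "v + t *\<^sub>R w"] by (simp add: power2_norm_eq_inner)
    also have "\<dots> = c * (v \<bullet> v) - v \<bullet> f v + 2 * t * (w \<bullet> (c *\<^sub>R v - f v)) + t\<^sup>2 * b"
      unfolding 1 2 b_def power2_norm_eq_inner by (simp add: inner_diff_right algebra_simps)
    also have "c * (v \<bullet> v) - v \<bullet> f v = 0"
      using v(1) by (simp add: c_def power2_norm_eq_inner[symmetric])
    finally show ?thesis by (simp add: w_def[symmetric] s_def power2_norm_eq_inner)
  qed
  note nonneg = this
  \<comment> \<open>At \<open>t = - r\<close> the quadratic equals
    \<open>- (r\<^sup>2 * (b + 2))\<close>, which forces \<open>r = 0\<close>. The denominator
    \<open>b + 1\<close> stays positive even when \<open>b = 0\<close>.\<close>
  define r where "r = s / (b + 1)"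
  have s: "s = r * (b + 1)" using b by (simp add: r_def)
  have "0 \<le> 2 * (- r) * s + (- r)\<^sup>2 * b" by (rule nonneg)
  also have "\<dots> = - (r\<^sup>2 * (b + 2))"
    unfolding s by (simp add: power2_eq_square algebra_simps)
  finally have "r\<^sup>2 * (b + 2) \<le> 0" by simp
  then have "r = 0" using b by (simp add: mult_le_0_iff)
  then have "s = 0" by (simp add: s)
  then have "f v = c *\<^sub>R v" by (simp add: s_def w_def)
  moreover have "v \<noteq> 0" using v(1) by auto
  ultimately show ?thesis using le that by blast
qed

lemma quadratic_form_le_lambda_max:
  fixes P :: "real^'n^'n"
  assumes "transpose P = P"
  shows "x \<bullet> (P *v x) \<le> lambda_max P * (norm x)\<^sup>2"
proof -
  have sa: "(P *v x) \<bullet> y = x \<bullet> (P *v y)" for x y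
    by (metis assms dot_lmul_matrix transpose_matrix_vector)
  have eq: "eigenvalues P = {c. \<exists>v. v \<noteq> 0 \<and> P *v v = c *\<^sub>R v}"
    by (simp add: eigenvalues_def scalar_mult_eq_scaleR)
  obtain c v where c: "v \<noteq> 0" "P *v v = c *\<^sub>R v" "\<And>x. x \<bullet> (P *v x) \<le> c * (norm x)\<^sup>2"
    using selfadjoint_max_eigenvalue[OF matrix_vector_mul_linear sa] by metis
  have "c \<le> lambda_max P"
    unfolding lambda_max_def using c selfadjoint_finite_eigenvalues[OF sa]
    by (intro Max_ge) (auto simp: eq)
  then have "c * (norm x)\<^sup>2 \<le> lambda_max P * (norm x)\<^sup>2" by (rule mult_right_mono) simp
  with c(3)[of x] show ?thesis by linarith
qed

text \<open>The inner product on \<open>complex^'n\<close> is the real part of the Hermitian one.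
  Multiplication by \<open>a\<close> already has the adjoint \<open>cnj a\<close> for it, so
  matrices keep their usual adjoint.\<close>

lemma inner_matrix_vector_conj_transpose:
  fixes M :: "complex^'n^'m"
  shows "(M *v x) \<bullet> y = x \<bullet> (conj_transpose M *v y)"
proof -
  have "(a * b) \<bullet> c = b \<bullet> (cnj a * c)" for a b c :: complex
    by (simp add: inner_complex_def algebra_simps)
  then show ?thesis
    by (simp add: inner_vec_def matrix_vector_mult_def conj_transpose_def transpose_def
        inner_sum_left inner_sum_right) (rule sum.swap)
qed

text \<open>The Rayleigh quotient of \<open>conj_transpose V ** V\<close> and of its negative yields
  the extreme eigenvalues. Eigenvalues of this map are nonnegative, so their square roots are
  singular values and lie between \<open>Min\<close> and \<open>Max\<close>.\<close>

lemma singular_value_bounds: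
  fixes V :: "complex^'n^'n"
  shows "norm (V *v x) \<le> Max (singular_values V) * norm x"
    and "Min (singular_values V) * norm x \<le> norm (V *v x)"
    and "Min (singular_values V) \<ge> 0"
    and "Max (singular_values V) \<ge> 0"
proof -
  let ?f = "\<lambda>x. (conj_transpose V ** V) *v x"
  let ?s = "singular_values V"
  have f: "x \<bullet> ?f y = (V *v x) \<bullet> (V *v y)" for x y
    by (simp add: inner_matrix_vector_conj_transpose matrix_vector_mul_assoc)
  have sa: "?f x \<bullet> y = x \<bullet> ?f y" for x y
    by (metis f inner_commute)
  have sa': "(- ?f x) \<bullet> y = x \<bullet> (- ?f y)" for x y
    by (simp add: sa)
  have lin: "linear ?f" by simp
  then have lin': "linear (\<lambda>x. - ?f x)" by (rule linear_compose_neg)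
  have sc: "complex_of_real r *s v = r *\<^sub>R v" for r and v :: "complex^'n"
    unfolding vec_eq_iff vector_scaleR_component vector_smult_component by (simp add: scaleR_conv_of_real)
  have eq: "?s = {s. 0 \<le> s \<and> s\<^sup>2 \<in> {c. \<exists>v. v \<noteq> 0 \<and> ?f v = c *\<^sub>R v}}" (is "_ = {s. 0 \<le> s \<and> s\<^sup>2 \<in> ?E}")
    by (simp add: singular_values_def eigenvalues_def sc del: of_real_power)
  have "finite ?E" by (rule selfadjoint_finite_eigenvalues[OF sa])
  then have "finite (sqrt ` ?E)" by (rule finite_imageI)
  moreover have "?s \<subseteq> sqrt ` ?E"
    unfolding eq by (force simp: image_iff intro!: bexI)
  ultimately have fin: "finite ?s" by (rule finite_subset[rotated])
  have mem: "sqrt c \<in> ?s" "0 \<le> c" if v: "v \<noteq> 0" "?f v = c *\<^sub>R v" for c v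
  proof -
    have "c * (norm v)\<^sup>2 = (norm (V *v v))\<^sup>2"
      using f[of v v] v by (simp add: power2_norm_eq_inner)
    then have "0 \<le> c * (norm v)\<^sup>2" by simp
    then show "0 \<le> c" using v(1) by (simp add: zero_le_mult_iff)
    then show "sqrt c \<in> ?s" using v unfolding eq by auto
  qed
  obtain c v where c: "v \<noteq> 0" "?f v = c *\<^sub>R v" "\<And>x. x \<bullet> ?f x \<le> c * (norm x)\<^sup>2"
    using selfadjoint_max_eigenvalue[OF lin sa] by metis
  obtain d w where d: "w \<noteq> 0" "- ?f w = d *\<^sub>R w" "\<And>x. x \<bullet> (- ?f x) \<le> d * (norm x)\<^sup>2"
    using selfadjoint_max_eigenvalue[OF lin' sa'] by metis
  have d2: "?f w = (- d) *\<^sub>R w" using d(2) by (metis minus_equation_iff scaleR_minus_left)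
  note mc = mem[OF c(1,2)] and md = mem[OF d(1) d2]
  have "(norm (V *v x))\<^sup>2 \<le> (sqrt c * norm x)\<^sup>2"
    using c(3)[of x] mc(2) by (simp add: f power2_norm_eq_inner[symmetric] power_mult_distrib)
  then have "norm (V *v x) \<le> sqrt c * norm x" by (rule power2_le_imp_le) (use mc in simp)
  also have "\<dots> \<le> Max ?s * norm x" by (intro mult_right_mono Max_ge fin mc) simp
  finally show "norm (V *v x) \<le> Max (singular_values V) * norm x" .
  have "(sqrt (- d) * norm x)\<^sup>2 \<le> (norm (V *v x))\<^sup>2"
    using d(3)[of x] md(2) by (simp add: f power2_norm_eq_inner[symmetric] power_mult_distrib)
  then have *: "sqrt (- d) * norm x \<le> norm (V *v x)" by (rule power2_le_imp_le) simp
  have "Min ?s * norm x \<le> sqrt (- d) * norm x" by (intro mult_right_mono Min_le fin md) simp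
  with * show "Min (singular_values V) * norm x \<le> norm (V *v x)" by linarith
  have "?s \<noteq> {}" using mc by auto
  then have "Min ?s \<in> ?s" "Max ?s \<in> ?s" using fin by (auto intro: Min_in Max_in)
  then show "Min (singular_values V) \<ge> 0" "Max (singular_values V) \<ge> 0" unfolding eq by auto
qed

subsection \<open>Detectability and unstable modes\<close>

text \<open>Dividing step \<open>s\<close> by \<open>l ^ Suc s\<close> makes the recurrence
  telescope. If \<open>z\<close> stays bounded and \<open>l\<close> has modulus above 1,
  \<open>z n / l ^ n\<close> vanishes in the limit and the forcing alone determines the initial
  value.\<close>

lemma linear_recurrence_initial_value:
  fixes l :: "'a::field"
  assumes "l \<noteq> 0" and "\<And>t. z (Suc t) = l * z t + h t"
  shows "z 0 = z n / l ^ n - (\<Sum>s<n. h s / l ^ Suc s)"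
proof (induction n)
  case (Suc n)
  have "z (Suc n) / l ^ Suc n = z n / l ^ n + h n / l ^ Suc n"
    using assms by (simp add: add_divide_distrib)
  with Suc show ?case by simp
qed simp

lemma sum_power_shifted_le:
  fixes r :: real
  assumes "0 \<le> r" "r < 1"
  shows "(\<Sum>s\<in>{T..<n}. r ^ Suc s) \<le> r ^ Suc T / (1 - r)"
proof -
  have "(\<Sum>s\<in>{T..<n}. r ^ Suc s) * (1 - r) = r ^ Suc T - r ^ Suc n" if "T \<le> n"
    using that
  proof (induction n rule: dec_induct)
    case (step m)
    then show ?case by (simp only: sum.atLeastLessThan_Suc[OF step.hyps(1)] distrib_right step.IH) (simp add: algebra_simps)
  qed simp
  moreover have "(\<Sum>s\<in>{T..<n}. r ^ Suc s) = 0" if "\<not> T \<le> n"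
    using that by simp
  ultimately have "(\<Sum>s\<in>{T..<n}. r ^ Suc s) * (1 - r) \<le> r ^ Suc T"
    using assms(1) by (cases "T \<le> n") simp_all
  then show ?thesis using assms(2) by (simp add: pos_le_divide_eq)
qed

lemma Bseq_bounded_linear:
  assumes "bounded_linear f" "Bseq x"
  shows "Bseq (\<lambda>t. f (x t))"
proof -
  obtain K where K: "\<And>t. norm (x t) \<le> K" using BseqD[OF assms(2)] by blast
  obtain L where L: "L \<ge> 0" "\<And>z. norm (f z) \<le> norm z * L"
    using bounded_linear.nonneg_bounded[OF assms(1)] by blast
  have "norm (f (x t)) \<le> K * L" for t
    using L(2)[of "x t"] mult_right_mono[OF K[of t] L(1)] by linarith
  then show ?thesis by (rule BseqI')
qed

lemma Bseq_diff:
  fixes x y :: "nat \<Rightarrow> 'a::real_normed_vector"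
  assumes "Bseq x" "Bseq y"
  shows "Bseq (\<lambda>t. x t - y t)"
proof -
  obtain K L where "\<And>t. norm (x t) \<le> K" "\<And>t. norm (y t) \<le> L"
    using BseqD[OF assms(1)] BseqD[OF assms(2)] by blast
  then have "norm (x t - y t) \<le> K + L" for t
    by (meson add_mono norm_triangle_le_diff order_refl order_trans)
  then show ?thesis by (rule BseqI')
qed

section \<open>Modal coordinates and hidden eigenvectors\<close>

lemma mat_vector_mult: "mat c *v v = c *s v" for v :: "'a::comm_semiring_1^'n"
  by (simp add: vec_eq_iff matrix_vector_mult_def mat_def if_distrib[of "\<lambda>a. a * _"] cong: if_cong)

lemma complex_matrix_diff: "complex_matrix (M - N) = complex_matrix M - complex_matrix N"
  by (simp add: vec_eq_iff)

lemma complex_matrix_mult: "complex_matrix (M ** N) = complex_matrix M ** complex_matrix N"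
  by (simp add: vec_eq_iff matrix_matrix_mult_def)

lemma diagonalized_by_inverse:
  assumes "diagonalized_by A V"
  shows "matrix_inv V *v (V *v z) = z" and "V *v (matrix_inv V *v z) = z"
proof -
  have "V ** matrix_inv V = mat 1 \<and> matrix_inv V ** V = mat 1"
    using assms unfolding diagonalized_by_def invertible_def matrix_inv_def by (metis (mono_tags, lifting) someI_ex)
  then show "matrix_inv V *v (V *v z) = z" and "V *v (matrix_inv V *v z) = z"
    by (simp_all add: matrix_vector_mul_assoc)
qed

text \<open>Row \<open>i\<close> of \<open>matrix_inv V\<close> is a left eigenvector of
  \<open>A\<close>, so the dynamics decouple into scalar recurrences.\<close>

lemma diagonalized_by_coordinate:
  assumes "diagonalized_by A V"
  shows "(matrix_inv V *v (complex_matrix A *v z)) $ i =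
    (matrix_inv V ** complex_matrix A ** V) $ i $ i * (matrix_inv V *v z) $ i"
proof -
  let ?D = "matrix_inv V ** complex_matrix A ** V"
  have D: "?D $ i $ j = 0" if "j \<noteq> i" for j
    using assms that by (auto simp: diagonalized_by_def diagonal_matrix_def)
  have "matrix_inv V *v (complex_matrix A *v z) = ?D *v (matrix_inv V *v z)"
    by (simp add: matrix_vector_mul_assoc[symmetric] diagonalized_by_inverse[OF assms])
  also have "\<dots> $ i = (\<Sum>j\<in>UNIV. ?D $ i $ j * (matrix_inv V *v z) $ j)"
    by (simp add: matrix_vector_mult_def)
  also have "\<dots> = (\<Sum>j\<in>UNIV. if j = i then ?D $ i $ i * (matrix_inv V *v z) $ i else 0)"
    by (intro sum.cong) (auto simp: D)
  finally show ?thesis by simp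
qed

text \<open>An eigenvector that \<open>C\<close> does not see is also an eigenvector of
  \<open>A - L ** C\<close> for every \<open>L\<close>, so no \<open>L\<close> could stabilise it.
  This is the necessity half of the Hautus test.\<close>

lemma detectable_eigenvector_visible:
  assumes "detectable A C" and "complex_matrix A *v z = l *s z" and "cmod l \<ge> 1"
    and "complex_matrix C *v z = 0"
  shows "z = 0"
proof (rule ccontr)
  assume "z \<noteq> 0"
  obtain L where L: "schur_stable (A - L ** C)" using assms(1) by (auto simp: detectable_def)
  have "complex_matrix (A - L ** C) *v z = l *s z"
    using assms(2,4)
    by (simp add: complex_matrix_diff complex_matrix_mult matrix_vector_mult_diff_rdistrib
        matrix_vector_mul_assoc[symmetric])
  with \<open>z \<noteq> 0\<close> have "l \<in> spec (A - L ** C)" by (auto simp: spec_def eigenvalues_def)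
  with L assms(3) show False by (force simp: schur_stable_def)
qed

text \<open>Multiplying the state by \<open>A - \<mu>\<close> for all eigenvalues \<open>\<mu>\<close> but one keeps the output
  bounded and moves the state into a single eigenspace, on which detectability makes the output
  injective.\<close>

lemma bounded_unstable_coordinate:
  fixes A :: "real^'n^'n" and C :: "real^'n^'p" and x d :: "nat \<Rightarrow> complex^'n"
  assumes diag: "diagonalized_by A V" and det: "detectable A C"
    and x: "\<And>t. x (Suc t) = complex_matrix A *v x t + d t"
    and d: "Bseq d" and y: "Bseq (\<lambda>t. complex_matrix C *v x t)"
    and ge: "cmod ((matrix_inv V ** complex_matrix A ** V) $ i $ i) \<ge> 1"
  shows "Bseq (\<lambda>t. (matrix_inv V *v x t) $ i)"
proof -
  define cA cC W where "cA = complex_matrix A" and "cC = complex_matrix C" and "W = matrix_inv V"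
  define l where "l j = (matrix_inv V ** complex_matrix A ** V) $ j $ j" for j
  have coord: "(W *v (cA *v z)) $ j = l j * (W *v z) $ j" for z j
    unfolding W_def cA_def l_def by (rule diagonalized_by_coordinate[OF diag])
  have VW: "V *v (W *v z) = z" for z
    unfolding W_def by (rule diagonalized_by_inverse[OF diag])
  have Bm: "Bseq (\<lambda>t. M *v z t)" if "Bseq z" for M :: "complex^'q^'r" and z
    by (rule Bseq_bounded_linear[OF _ that]) simp
  \<comment> \<open>\<open>x'\<close> is \<open>x\<close> with \<open>A - \<mu>\<close> applied for
    every \<open>\<mu>\<close> in \<open>F\<close>. It obeys the same dynamics with another bounded
    forcing.\<close>
  have "\<exists>x' d'. (\<forall>t. x' (Suc t) = cA *v x' t + d' t) \<and> Bseq d' \<and> Bseq (\<lambda>t. cC *v x' t) \<and>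
      (\<forall>t j. (W *v x' t) $ j = (\<Prod>\<mu>\<in>F. l j - \<mu>) * (W *v x t) $ j)"
    if "finite F" for F
    using that
  proof induction
    case empty
    show ?case using x d y unfolding cA_def cC_def by (intro exI[of _ x] exI[of _ d]) simp
  next
    case (insert \<mu> F)
    then obtain x' d' where x': "\<And>t. x' (Suc t) = cA *v x' t + d' t" and d': "Bseq d'"
      and y': "Bseq (\<lambda>t. cC *v x' t)"
      and W': "\<And>t j. (W *v x' t) $ j = (\<Prod>\<mu>\<in>F. l j - \<mu>) * (W *v x t) $ j"
      by blast
    define x'' where "x'' t = cA *v x' t - \<mu> *s x' t" for t
    define d'' where "d'' t = cA *v d' t - mat \<mu> *v d' t" for t
    have rec: "x'' (Suc t) = cA *v x'' t + d'' t" for t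
      by (simp add: x''_def d''_def x' matrix_vector_right_distrib matrix_vector_mult_diff_distrib
          mat_vector_mult vector_scalar_commute vector_add_ldistrib)
    have Bd: "Bseq d''" unfolding d''_def by (intro Bseq_diff Bm d')
    \<comment> \<open>The state is not yet known to be bounded, so the output of
      \<open>cA *v x' t\<close> is expressed through the next output and the forcing.\<close>
    have "cC *v x'' t = cC *v x' (Suc t) - cC *v d' t - mat \<mu> *v (cC *v x' t)" for t
      by (simp add: x''_def x' matrix_vector_right_distrib matrix_vector_mult_diff_distrib
          mat_vector_mult vector_scalar_commute)
    moreover have "Bseq (\<lambda>t. cC *v x' (Suc t) - cC *v d' t - mat \<mu> *v (cC *v x' t))"
      by (intro Bseq_diff Bm d' y' y'[THEN Bseq_Suc_iff[THEN iffD2]])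
    ultimately have By: "Bseq (\<lambda>t. cC *v x'' t)" by simp
    have "(W *v x'' t) $ j = (\<Prod>\<mu>\<in>insert \<mu> F. l j - \<mu>) * (W *v x t) $ j" for t j
      using insert.hyps
      by (simp add: x''_def matrix_vector_mult_diff_distrib coord vector_scalar_commute
          W' algebra_simps)
    with rec Bd By show ?case by blast
  qed
  \<comment> \<open>This choice of \<open>F\<close> annihilates every mode with
    \<open>l j \<noteq> l i\<close> and leaves the eigenspace of \<open>l i\<close>.\<close>
  from this[of "range l - {l i}"] obtain x' d' where
    y': "Bseq (\<lambda>t. cC *v x' t)"
    and W': "\<And>t j. (W *v x' t) $ j = (\<Prod>\<mu>\<in>range l - {l i}. l j - \<mu>) * (W *v x t) $ j"
    by auto
  have eig: "cA *v x' t = l i *s x' t" for t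
  proof -
    have "(W *v (cA *v x' t)) $ j = (W *v (l i *s x' t)) $ j" for j
    proof (cases "l j = l i")
      case False
      then have "(\<Prod>\<mu>\<in>range l - {l i}. l j - \<mu>) = 0" by (intro prod_zero) auto
      then show ?thesis by (simp add: coord vector_scalar_commute W')
    qed (simp add: coord vector_scalar_commute)
    then have "W *v (cA *v x' t) = W *v (l i *s x' t)" by (simp add: vec_eq_iff)
    then show ?thesis by (metis VW)
  qed
  \<comment> \<open>A nonzero kernel vector of \<open>f\<close> would be an eigenvector for
    \<open>l i\<close> hidden from \<open>C\<close>. Hence \<open>f\<close> is injective and bounded
    below; its second component vanishes on \<open>x' t\<close>, so the output alone bounds the
    state.\<close>
  define f where "f z = (cC *v z, cA *v z - mat (l i) *v z)" for z
  have "linear f"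
    unfolding f_def
    by (intro bounded_linear.linear bounded_linear_Pair bounded_linear_sub
        matrix_vector_mul_bounded_linear)
  moreover have "inj f"
  proof (subst linear_injective_0[OF \<open>linear f\<close>], intro allI impI)
    fix z assume "f z = 0"
    then show "z = 0"
      using detectable_eigenvector_visible[OF det, of z "l i"] ge
      by (simp add: f_def l_def cA_def cC_def mat_vector_mult zero_prod_def)
  qed
  ultimately obtain e where e: "e > 0" "\<And>z. e * norm z \<le> norm (f z)"
    using linear_inj_bounded_below_pos by metis
  obtain K where K: "\<And>t. norm (cC *v x' t) \<le> K" using BseqD[OF y'] by blast
  have "norm (x' t) \<le> K / e" for t
  proof -
    have "f (x' t) = (cC *v x' t, 0)" by (simp add: f_def eig mat_vector_mult)
    then have "e * norm (x' t) \<le> K" using e(2)[of "x' t"] K[of t] by simp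
    then show ?thesis using e(1) by (simp add: pos_le_divide_eq mult.commute)
  qed
  then have "Bseq x'" by (rule BseqI')
  then have "Bseq (\<lambda>t. (W *v x' t) $ i)"
    using Bseq_bounded_linear[OF bounded_linear_vec_nth Bm] by blast
  moreover define p where "p = (\<Prod>\<mu>\<in>range l - {l i}. l i - \<mu>)"
  moreover have "p \<noteq> 0" by (auto simp: p_def)
  moreover have "(W *v x' t) $ i = p * (W *v x t) $ i" for t by (simp add: W' p_def)
  ultimately have "Bseq (\<lambda>t. p * (W *v x t) $ i)" by simp
  then show ?thesis unfolding W_def[symmetric] using Bseq_cmult_iff[OF \<open>p \<noteq> 0\<close>] by simp
qed

subsection \<open>Near-optimal complex trajectories\<close>

definition complexify :: "real^'n \<Rightarrow> real^'n \<Rightarrow> complex^'n" where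
  "complexify a b = (\<chi> i. Complex (a $ i) (b $ i))"

lemma complexify_surj: obtains a b where "z = complexify a b"
  by (rule that[of "\<chi> i. Re (z $ i)" "\<chi> i. Im (z $ i)"]) (simp add: complexify_def vec_eq_iff)

lemma complexify_add: "complexify (a + c) (b + d) = complexify a b + complexify c d"
  by (simp add: complexify_def vec_eq_iff complex_eq_iff)

lemma complex_matrix_complexify: "complex_matrix M *v complexify a b = complexify (M *v a) (M *v b)"
  by (simp add: complexify_def vec_eq_iff complex_eq_iff matrix_vector_mult_def)

lemma norm_complexify: "(norm (complexify a b))\<^sup>2 = (norm a)\<^sup>2 + (norm b)\<^sup>2"
  by (simp add: power2_norm_eq_inner complexify_def inner_vec_def inner_complex_def sum.distrib)

text \<open>Equal cardinalities force the columns to be distinct unit vectors, hence orthonormal, so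
  \<open>B\<close> is an isometry. With \<open>R = I\<close> the input cost is then the energy of
  \<open>B *v u\<close>.\<close>

lemma norm_input_matrix:
  fixes B :: "real^'s^'n"
  assumes "input_matrix S B" "S \<subseteq> cart_basis"
  shows "norm (B *v u) = norm u"
proof -
  have cols: "range (\<lambda>j. column j B) = S" and card: "CARD('s) = card S"
    using assms(1) by (auto simp: input_matrix_def columns_def)
  have "inj (\<lambda>j. column j B)" by (rule eq_card_imp_inj_on) (simp_all add: cols card)
  have col: "column j B \<bullet> column k B = (if j = k then 1 else 0)" for j k
  proof -
    have "column j B \<in> cart_basis" "column k B \<in> cart_basis" using cols assms(2) by blast+
    then obtain i i' where "column j B = axis i 1" "column k B = axis i' 1"
      by (auto simp: cart_basis_def)
    moreover have "i = i' \<longleftrightarrow> j = k"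
      using calculation injD[OF \<open>inj _\<close>, of j k] by (auto simp: axis_eq_axis)
    ultimately show ?thesis by (simp add: inner_axis_axis)
  qed
  have "(transpose B ** B) $ j $ k = column j B \<bullet> column k B" for j k
    by (simp add: matrix_matrix_mult_def transpose_def column_def inner_vec_def)
  then have "transpose B ** B = mat 1"
    by (simp add: vec_eq_iff mat_def col)
  then have "(B *v u) \<bullet> (B *v u) = u \<bullet> u"
    by (metis dot_lmul_matrix matrix_vector_mul_assoc matrix_vector_mul_lid transpose_matrix_vector
        transpose_transpose inner_commute)
  then show ?thesis by (simp add: norm_eq_sqrt_inner)
qed

text \<open>Settling for a slack \<open>\<epsilon>\<close> avoids having to show that the infimum is
  attained. The \<open>ennreal\<close> series becomes a uniform bound on real partial sums.\<close>

lemma near_optimal_input: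
  fixes A Q P Qhalf :: "real^'n^'n" and B :: "real^'s^'n"
  assumes opt: "optimal_cost_matrix A B Q (mat 1) P" and sqrt: "is_psd_sqrt Qhalf Q"
    and "\<epsilon> > 0"
  obtains u where "\<And>n. (\<Sum>t<n. (norm (Qhalf *v trajectory A B x0 u t))\<^sup>2 + (norm (u t))\<^sup>2)
    \<le> x0 \<bullet> (P *v x0) + \<epsilon>"
proof -
  have Q: "x \<bullet> (Q *v x) = (norm (Qhalf *v x))\<^sup>2" for x
    using sqrt unfolding is_psd_sqrt_def sym_psd_def
    by (metis dot_lmul_matrix matrix_vector_mul_assoc power2_norm_eq_inner transpose_matrix_vector)
  have P0: "0 \<le> x0 \<bullet> (P *v x0)" and
    P: "(INF u. lqr_cost A B Q (mat 1) x0 u) = ennreal (x0 \<bullet> (P *v x0))"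
    using opt by (simp_all add: optimal_cost_matrix_def sym_psd_def)
  have "ennreal (x0 \<bullet> (P *v x0)) < ennreal (x0 \<bullet> (P *v x0) + \<epsilon>)"
    using P0 assms(3) by (simp add: ennreal_less_iff)
  then obtain u where u: "lqr_cost A B Q (mat 1) x0 u < ennreal (x0 \<bullet> (P *v x0) + \<epsilon>)"
    unfolding P[symmetric] by (auto simp: INF_less_iff)
  have "(\<Sum>t<n. (norm (Qhalf *v trajectory A B x0 u t))\<^sup>2 + (norm (u t))\<^sup>2) \<le> x0 \<bullet> (P *v x0) + \<epsilon>" for n
  proof -
    have "ennreal (\<Sum>t<n. (norm (Qhalf *v trajectory A B x0 u t))\<^sup>2 + (norm (u t))\<^sup>2)
        = (\<Sum>t<n. ennreal ((norm (Qhalf *v trajectory A B x0 u t))\<^sup>2 + (norm (u t))\<^sup>2))"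
      by (rule sum_ennreal[symmetric]) simp
    also have "\<dots> \<le> lqr_cost A B Q (mat 1) x0 u"
      unfolding lqr_cost_def Q by (simp add: power2_norm_eq_inner sum_le_suminf)
    also note u
    finally show ?thesis by (subst (asm) ennreal_less_iff) (simp_all add: sum_nonneg)
  qed
  then show ?thesis by (rule that)
qed

lemma summable_norm_square_imp_Bseq:
  assumes "\<And>n. (\<Sum>t<n. (norm (x t))\<^sup>2) \<le> K"
  shows "Bseq x"
proof (rule BseqI')
  fix t
  have "(norm (x t))\<^sup>2 \<le> (\<Sum>t<Suc t. (norm (x t))\<^sup>2)" by (simp add: sum_nonneg)
  also have "\<dots> \<le> K" by (rule assms)
  finally show "norm (x t) \<le> sqrt K" by (rule real_le_rsqrt)
qed

text \<open>Complex initial states are steered by pairs of real inputs; this avoids the loss of a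
  factor two when a complex left eigenvector is probed by real states.\<close>

lemma near_optimal_complex_trajectory:
  fixes A Q P Qhalf :: "real^'n^'n" and B :: "real^'s^'n" and q :: "complex^'n"
  assumes opt: "optimal_cost_matrix A B Q (mat 1) P" and sqrt: "is_psd_sqrt Qhalf Q"
    and B: "input_matrix S B" "S \<subseteq> cart_basis" and "\<epsilon> > 0"
  obtains x w where "x 0 = q" and "\<And>t. x (Suc t) = complex_matrix A *v x t + complex_matrix B *v w t"
    and "Bseq (\<lambda>t. complex_matrix B *v w t)" and "Bseq (\<lambda>t. complex_matrix Qhalf *v x t)"
    and "\<And>n. (\<Sum>t<n. (norm (complex_matrix B *v w t))\<^sup>2) \<le> lambda_max P * (norm q)\<^sup>2 + \<epsilon>"
proof -
  obtain a b where q: "q = complexify a b" by (rule complexify_surj)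
  have "\<epsilon> / 2 > 0" using assms by simp
  obtain u where u: "\<And>n. (\<Sum>t<n. (norm (Qhalf *v trajectory A B a u t))\<^sup>2 + (norm (u t))\<^sup>2)
    \<le> a \<bullet> (P *v a) + \<epsilon> / 2"
    by (rule near_optimal_input[OF opt sqrt \<open>\<epsilon> / 2 > 0\<close>, of a]) blast
  obtain v where v: "\<And>n. (\<Sum>t<n. (norm (Qhalf *v trajectory A B b v t))\<^sup>2 + (norm (v t))\<^sup>2)
    \<le> b \<bullet> (P *v b) + \<epsilon> / 2"
    by (rule near_optimal_input[OF opt sqrt \<open>\<epsilon> / 2 > 0\<close>, of b]) blast
  define x where "x t = complexify (trajectory A B a u t) (trajectory A B b v t)" for t
  define w where "w t = complexify (u t) (v t)" for t
  let ?K = "lambda_max P * (norm q)\<^sup>2 + \<epsilon>"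
  have sym: "transpose P = P" using opt by (simp add: optimal_cost_matrix_def sym_psd_def)
  have Bw: "(norm (complex_matrix B *v w t))\<^sup>2 = (norm (u t))\<^sup>2 + (norm (v t))\<^sup>2" for t
    by (simp add: w_def complex_matrix_complexify norm_complexify norm_input_matrix[OF B])
  have Qx: "(norm (complex_matrix Qhalf *v x t))\<^sup>2 =
    (norm (Qhalf *v trajectory A B a u t))\<^sup>2 + (norm (Qhalf *v trajectory A B b v t))\<^sup>2" for t
    by (simp add: x_def complex_matrix_complexify norm_complexify)
  have sum: "(\<Sum>t<n. (norm (complex_matrix Qhalf *v x t))\<^sup>2) +
      (\<Sum>t<n. (norm (complex_matrix B *v w t))\<^sup>2) \<le> ?K" for n
  proof -
    have "(\<Sum>t<n. (norm (complex_matrix Qhalf *v x t))\<^sup>2) + (\<Sum>t<n. (norm (complex_matrix B *v w t))\<^sup>2)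
      \<le> a \<bullet> (P *v a) + b \<bullet> (P *v b) + \<epsilon>"
      using u[of n] v[of n] by (simp add: Bw Qx sum.distrib)
    \<comment> \<open>The form of \<open>P\<close> is bounded on the real and imaginary parts
      separately; their squared norms add up to that of \<open>q\<close>.\<close>
    also have "\<dots> \<le> lambda_max P * (norm a)\<^sup>2 + lambda_max P * (norm b)\<^sup>2 + \<epsilon>"
      by (intro add_mono quadratic_form_le_lambda_max[OF sym]) simp
    also have "\<dots> = ?K" by (simp add: q norm_complexify algebra_simps)
    finally show ?thesis .
  qed
  have sw: "(\<Sum>t<n. (norm (complex_matrix B *v w t))\<^sup>2) \<le> ?K" for n
    using sum[of n] sum_nonneg[of "{..<n}" "\<lambda>t. (norm (complex_matrix Qhalf *v x t))\<^sup>2"] by simp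
  have sx: "(\<Sum>t<n. (norm (complex_matrix Qhalf *v x t))\<^sup>2) \<le> ?K" for n
    using sum[of n] sum_nonneg[of "{..<n}" "\<lambda>t. (norm (complex_matrix B *v w t))\<^sup>2"] by simp
  show ?thesis
  proof (rule that[of x w])
    show "x 0 = q" by (simp add: x_def q)
    show "x (Suc t) = complex_matrix A *v x t + complex_matrix B *v w t" for t
      by (simp add: x_def w_def complex_matrix_complexify complexify_add)
  qed (rule summable_norm_square_imp_Bseq[OF sw] summable_norm_square_imp_Bseq[OF sx] sw)+
qed

subsection \<open>The lower bound\<close>

text \<open>The inner product is real, so orthogonality to the complex line through \<open>g\<close>
  takes two real conditions.\<close>

lemma inner_i_smult_eq_0:
  fixes y g :: "complex^'n"
  assumes "y \<bullet> g = 0" "y \<bullet> (\<i> *s g) = 0"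
  shows "y \<bullet> (c *s g) = 0"
proof -
  have "c *s g = Re c *\<^sub>R g + Im c *\<^sub>R (\<i> *s g)"
    by (simp add: vec_eq_iff complex_eq_iff)
  then show ?thesis using assms by (simp add: inner_add_right)
qed

text \<open>Dimension count: at most \<open>card K * CARD('s) + (CARD('n) - card I)\<close> complex
  conditions are imposed, fewer than \<open>CARD('n)\<close>. Adding the
  \<open>\<i>\<close>-multiples in \<open>H\<close> at most doubles the count, which stays below the
  real dimension \<open>2 * CARD('n)\<close>.\<close>

lemma exists_supported_orthogonal_vector:
  fixes N :: "'k \<Rightarrow> complex^'s^'n" and I :: "'n set"
  assumes "finite K" "card K * CARD('s) < card I"
  obtains y where "y \<noteq> 0" and "\<And>i. i \<notin> I \<Longrightarrow> y $ i = 0"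
    and "\<And>k w. k \<in> K \<Longrightarrow> y \<bullet> (N k *v w) = 0"
proof -
  define G where "G = (\<lambda>(k, j). column j (N k)) ` (K \<times> UNIV) \<union> (\<lambda>i. axis i 1) ` (- I)"
  define H where "H = G \<union> (\<lambda>g. \<i> *s g) ` G"
  have "card G \<le> card ((\<lambda>(k, j). column j (N k)) ` (K \<times> (UNIV::'s set))) + card ((\<lambda>i. axis i (1::complex)) ` (- I))"
    unfolding G_def by (rule card_Un_le)
  also have "\<dots> \<le> card (K \<times> (UNIV::'s set)) + card (- I)"
    by (intro add_mono card_image_le) (use assms in auto)
  also have "\<dots> = card K * CARD('s) + (CARD('n) - card I)"
    by (simp add: card_cartesian_product Compl_eq_Diff_UNIV card_Diff_subset)
  also have "\<dots> < CARD('n)"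
    using assms(2) card_mono[of UNIV I] by simp
  finally have G: "card G < CARD('n)" .
  have finG: "finite G" using assms(1) by (simp add: G_def)
  have "card H \<le> card G + card ((\<lambda>g. \<i> *s g) ` G)" unfolding H_def by (rule card_Un_le)
  also have "\<dots> \<le> 2 * card G" using card_image_le[OF finG, of "\<lambda>g. \<i> *s g"] by simp
  also have "\<dots> < DIM(complex^'n)" using G by simp
  finally have "card H < DIM(complex^'n)" .
  moreover have "dim H \<le> card H" using finG by (intro dim_le_card') (simp add: H_def)
  ultimately have "dim H < DIM(complex^'n)" by linarith
  then obtain y where y: "y \<noteq> 0" "\<And>h. h \<in> span H \<Longrightarrow> orthogonal y h"
    using orthogonal_to_subspace_exists by blast
  have yG: "y \<bullet> (c *s g) = 0" if "g \<in> G" for c g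
  proof (rule inner_i_smult_eq_0)
    have "g \<in> H" "\<i> *s g \<in> H" using that unfolding H_def by blast+
    then show "y \<bullet> g = 0" "y \<bullet> (\<i> *s g) = 0"
      using y(2) span_base unfolding orthogonal_def by blast+
  qed
  show ?thesis
  proof (rule that[OF y(1)])
    fix i assume "i \<notin> I"
    then have G: "axis i 1 \<in> G" by (auto simp: G_def)
    \<comment> \<open>Scaling the axis by \<open>y $ i\<close> makes this inner product the squared
      norm of \<open>y $ i\<close>.\<close>
    have "y \<bullet> axis i (y $ i) = 0"
    proof -
      have "(y $ i) *s axis i 1 = axis i (y $ i)" by (simp add: vec_eq_iff axis_def)
      then show ?thesis using yG[OF G, of "y $ i"] by simp
    qed
    then show "y $ i = 0" by (simp add: inner_axis)
  next
    fix k w assume "k \<in> K"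
    then have "column j (N k) \<in> G" for j by (auto simp: G_def)
    then show "y \<bullet> (N k *v w) = 0"
      unfolding matrix_mult_sum inner_sum_right by (intro sum.neutral) (simp add: yG)
  qed
qed

text \<open>The core estimate, free of division. \<open>Max\<close> enters when \<open>y\<close> is
  bounded by the initial state, \<open>Min\<close> when a force is compared with its modal
  coordinates. Counting indices \<open>i\<close> counts eigenvalues with multiplicity.\<close>

lemma lambda_max_singular_value_bound:
  fixes A Q P Qhalf :: "real^'n^'n" and B :: "real^'s^'n" and V :: "complex^'n^'n"
  assumes diag: "diagonalized_by A V" and det: "detectable A Qhalf"
    and opt: "optimal_cost_matrix A B Q (mat 1) P" and sqrt: "is_psd_sqrt Qhalf Q"
    and B: "input_matrix S B" "S \<subseteq> cart_basis" and \<eta>: "\<eta> > 1"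
    and T: "T * CARD('s) < card {i. \<eta> \<le> cmod ((matrix_inv V ** complex_matrix A ** V) $ i $ i)}"
  shows "(Min (singular_values V))\<^sup>2 * ((\<eta>\<^sup>2 - 1) * (\<eta> ^ T)\<^sup>2)
    \<le> (Max (singular_values V))\<^sup>2 * lambda_max P"
proof -
  define W cB where "W = matrix_inv V" and "cB = complex_matrix B"
  define l where "l i = (matrix_inv V ** complex_matrix A ** V) $ i $ i" for i
  define I where "I = {i. \<eta> \<le> cmod (l i)}"
  define sm sM where "sm = Min (singular_values V)" and "sM = Max (singular_values V)"
  define lP where "lP = lambda_max P"
  note sv = singular_value_bounds[of V, folded sm_def sM_def]
  note WV = diagonalized_by_inverse[OF diag, folded W_def]
  have coord: "(W *v (complex_matrix A *v z)) $ i = l i * (W *v z) $ i" for z i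
    unfolding W_def l_def by (rule diagonalized_by_coordinate[OF diag])
  \<comment> \<open>\<open>N s\<close> sends the input at time \<open>s\<close> to its contribution,
    up to sign, to the initial modes in the solved recurrence.\<close>
  define N where "N s = (\<chi> i j. (W ** cB) $ i $ j / l i ^ Suc s)" for s
  have N: "(N s *v w) $ i = (W *v (cB *v w)) $ i / l i ^ Suc s" for s w i
    unfolding matrix_vector_mul_assoc
    by (simp add: N_def matrix_vector_mult_def sum_divide_distrib)
  obtain y where y0: "y \<noteq> 0" and yI: "\<And>i. i \<notin> I \<Longrightarrow> y $ i = 0"
    and yN: "\<And>s w. s < T \<Longrightarrow> y \<bullet> (N s *v w) = 0"
    using exists_supported_orthogonal_vector[of "{..<T}" I N] T by (auto simp: I_def l_def)
  have y_inner: "y \<bullet> z = (\<Sum>i\<in>I. y $ i \<bullet> z $ i)" for z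
    unfolding inner_vec_def by (rule sum.mono_neutral_right) (auto simp: yI)
  \<comment> \<open>With this initial state, pairing the initial modes with \<open>y\<close> gives
    \<open>(norm q)\<^sup>2\<close>.\<close>
  define q where "q = conj_transpose W *v y"
  have q: "(norm q)\<^sup>2 = y \<bullet> (W *v q)"
    using inner_matrix_vector_conj_transpose[of W q y]
    by (simp add: q_def power2_norm_eq_inner inner_commute)
  have "(norm y)\<^sup>2 = (V *v y) \<bullet> q"
    unfolding q_def inner_matrix_vector_conj_transpose[symmetric] WV power2_norm_eq_inner ..
  also have "\<dots> \<le> norm (V *v y) * norm q" by (rule norm_cauchy_schwarz)
  also have "\<dots> \<le> (sM * norm y) * norm q" by (intro mult_right_mono sv) simp
  finally have "norm y * norm y \<le> (sM * norm q) * norm y" by (simp add: power2_eq_square mult_ac)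
  then have yq: "norm y \<le> sM * norm q" using y0 by simp
  then have q0: "norm q > 0" using y0 by (cases "q = 0") auto
  \<comment> \<open>The sum of \<open>(1 / \<eta>\<^sup>2) ^ Suc s\<close> over all
    \<open>s \<ge> T\<close>.\<close>
  define G where "G = 1 / ((\<eta>\<^sup>2 - 1) * (\<eta> ^ T)\<^sup>2)"
  have \<eta>2: "\<eta>\<^sup>2 > 1" using \<eta> by simp
  have G0: "G > 0" using \<eta> \<eta>2 by (simp add: G_def)
  have main: "(sm * (norm q)\<^sup>2)\<^sup>2 \<le> (norm y)\<^sup>2 * G * (lP * (norm q)\<^sup>2 + \<epsilon>)" if \<epsilon>: "\<epsilon> > 0" for \<epsilon>
  proof -
    define J where "J = lP * (norm q)\<^sup>2 + \<epsilon>"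
    obtain x w where x0: "x 0 = q" and x: "\<And>t. x (Suc t) = complex_matrix A *v x t + cB *v w t"
      and Bw: "Bseq (\<lambda>t. cB *v w t)" and Bx: "Bseq (\<lambda>t. complex_matrix Qhalf *v x t)"
      and J: "\<And>n. (\<Sum>t<n. (norm (cB *v w t))\<^sup>2) \<le> J"
      unfolding J_def cB_def lP_def
      by (rule near_optimal_complex_trajectory[OF opt sqrt B \<epsilon>, of q]) blast
    have J0: "J \<ge> 0" using J[of 0] by simp
    have bdd: "Bseq (\<lambda>t. (W *v x t) $ i)" if "i \<in> I" for i
      unfolding W_def by (rule bounded_unstable_coordinate[OF diag det x Bw Bx])
        (use that \<eta> in \<open>simp add: I_def l_def\<close>)
    define e where "e n = (\<Sum>i\<in>I. y $ i \<bullet> ((W *v x n) $ i / l i ^ n))" for n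
    \<comment> \<open>\<open>e n\<close> is the remainder carried by the state at time
      \<open>n\<close>. The terms with \<open>s < T\<close> vanish by the choice of
      \<open>y\<close>.\<close>
    have split: "(norm q)\<^sup>2 = e n - (\<Sum>s\<in>{T..<n}. y \<bullet> (N s *v w s))" for n
    proof -
      have "(W *v q) $ i = (W *v x n) $ i / l i ^ n - (\<Sum>s<n. (N s *v w s) $ i)" if "i \<in> I" for i
      proof -
        have "l i \<noteq> 0" using that \<eta> by (auto simp: I_def)
        from linear_recurrence_initial_value[OF this, of "\<lambda>t. (W *v x t) $ i" "\<lambda>t. (W *v (cB *v w t)) $ i"]
        show ?thesis by (simp add: x x0 N coord matrix_vector_right_distrib)
      qed
      then have "(norm q)\<^sup>2 = (\<Sum>i\<in>I. y $ i \<bullet> ((W *v x n) $ i / l i ^ n - (\<Sum>s<n. (N s *v w s) $ i)))"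
        unfolding q y_inner by (intro sum.cong) auto
      also have "\<dots> = e n - (\<Sum>i\<in>I. \<Sum>s<n. y $ i \<bullet> (N s *v w s) $ i)"
        by (simp add: e_def inner_diff_right inner_sum_right sum_subtractf)
      also have "(\<Sum>i\<in>I. \<Sum>s<n. y $ i \<bullet> (N s *v w s) $ i) = (\<Sum>s<n. y \<bullet> (N s *v w s))"
        unfolding y_inner by (rule sum.swap)
      also have "\<dots> = (\<Sum>s\<in>{T..<n}. y \<bullet> (N s *v w s))"
        by (rule sum.mono_neutral_right) (auto simp: yN)
      finally show ?thesis .
    qed
    have "(\<lambda>n. (W *v x n) $ i / l i ^ n) \<longlonglongrightarrow> 0" if i: "i \<in> I" for i
    proof -
      obtain K where K: "\<And>n. norm ((W *v x n) $ i) \<le> K" using BseqD[OF bdd[OF i]] by blast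
      show ?thesis
      proof (rule Lim_null_comparison)
        show "(\<lambda>n. K * (1 / \<eta>) ^ n) \<longlonglongrightarrow> 0"
          using \<eta> by (intro tendsto_mult_right_zero LIMSEQ_power_zero) simp
        have "norm ((W *v x n) $ i / l i ^ n) \<le> K / \<eta> ^ n" for n
          unfolding norm_divide norm_power
          using \<eta> i K order_trans[OF norm_ge_zero K] by (intro frac_le power_mono) (auto simp: I_def)
        then show "\<forall>\<^sub>F n in sequentially. norm ((W *v x n) $ i / l i ^ n) \<le> K * (1 / \<eta>) ^ n"
          by (simp add: power_one_over)
      qed
    qed
    then have e: "e \<longlonglongrightarrow> 0"
      unfolding e_def by (intro tendsto_null_sum tendsto_inner[OF tendsto_const, of _ 0, simplified])
    have step: "sm * \<bar>y \<bullet> (N s *v w s)\<bar> \<le> norm y * ((1 / \<eta>) ^ Suc s * norm (cB *v w s))" for s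
    proof -
      \<comment> \<open>The bound \<open>\<eta> \<le> cmod (l i)\<close> holds only on
        \<open>I\<close>, so the vector is truncated to \<open>I\<close> before it is compared with
        \<open>v\<close>. Pairing with \<open>y\<close> is unchanged.\<close>
      define z where "z = (\<chi> i. if i \<in> I then (N s *v w s) $ i else 0)"
      define v where "v = W *v (cB *v w s)"
      have "norm (z $ i) \<le> norm (((1 / \<eta>) ^ Suc s *\<^sub>R v) $ i)" for i
      proof (cases "i \<in> I")
        case True
        have "norm (v $ i) / cmod (l i) ^ Suc s \<le> norm (v $ i) / \<eta> ^ Suc s"
          using True \<eta> by (intro divide_left_mono power_mono mult_pos_pos zero_less_power) (auto simp: I_def)
        moreover have "norm (z $ i) = norm (v $ i) / cmod (l i) ^ Suc s"
          using True by (simp only: z_def N v_def[symmetric] norm_divide norm_power vec_lambda_beta if_True)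
        moreover have "norm (((1 / \<eta>) ^ Suc s *\<^sub>R v) $ i) = norm (v $ i) / \<eta> ^ Suc s"
          using \<eta> by (simp only: vector_scaleR_component norm_scaleR power_one_over) simp
        ultimately show ?thesis by simp
      qed (simp add: z_def)
      then have "norm z \<le> norm ((1 / \<eta>) ^ Suc s *\<^sub>R v)" by (rule norm_le_componentwise_cart)
      then have z: "norm z \<le> (1 / \<eta>) ^ Suc s * norm v" using \<eta> by simp
      have "y \<bullet> (N s *v w s) = y \<bullet> z" by (simp add: y_inner z_def)
      then have "\<bar>y \<bullet> (N s *v w s)\<bar> \<le> norm y * norm z" using Cauchy_Schwarz_ineq2[of y z] by simp
      also have "\<dots> \<le> norm y * ((1 / \<eta>) ^ Suc s * norm v)" by (intro mult_left_mono z) simp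
      finally have "sm * \<bar>y \<bullet> (N s *v w s)\<bar> \<le> sm * (norm y * ((1 / \<eta>) ^ Suc s * norm v))"
        using sv(3) by (rule mult_left_mono)
      also have "\<dots> = norm y * ((1 / \<eta>) ^ Suc s * (sm * norm v))" by (simp add: mult_ac)
      \<comment> \<open>Since \<open>V *v v = cB *v w s\<close>, the lower singular value bound
        replaces \<open>sm * norm v\<close> by the norm of the applied force.\<close>
      also have "\<dots> \<le> norm y * ((1 / \<eta>) ^ Suc s * norm (cB *v w s))"
        using sv(2)[of v] \<eta> by (intro mult_left_mono) (simp_all add: v_def WV)
      finally show ?thesis .
    qed
    have sq: "(r ^ k)\<^sup>2 = (r\<^sup>2) ^ k" for r :: real and k
      by (simp only: power_mult[symmetric] mult.commute)
    have CS: "(\<Sum>s\<in>{T..<n}. (1 / \<eta>) ^ Suc s * norm (cB *v w s)) \<le> sqrt (G * J)" for n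
    proof (rule real_le_rsqrt)
      have "(\<Sum>s\<in>{T..<n}. (1 / \<eta>) ^ Suc s * norm (cB *v w s))\<^sup>2
        \<le> (\<Sum>s\<in>{T..<n}. ((1 / \<eta>) ^ Suc s)\<^sup>2) * (\<Sum>s\<in>{T..<n}. (norm (cB *v w s))\<^sup>2)"
        by (rule Cauchy_Schwarz_ineq_sum)
      also have "\<dots> \<le> G * J"
      proof (rule mult_mono)
        have "(\<Sum>s\<in>{T..<n}. ((1 / \<eta>) ^ Suc s)\<^sup>2) = (\<Sum>s\<in>{T..<n}. (1 / \<eta>\<^sup>2) ^ Suc s)"
          by (simp only: sq power_one_over[of _ 2])
        also have "\<dots> \<le> (1 / \<eta>\<^sup>2) ^ Suc T / (1 - 1 / \<eta>\<^sup>2)"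
          using \<eta>2 by (intro sum_power_shifted_le) (auto simp: divide_less_eq)
        also have "\<dots> = G"
        proof -
          have "1 - 1 / \<eta>\<^sup>2 = (\<eta>\<^sup>2 - 1) / \<eta>\<^sup>2" using \<eta> by (simp add: diff_divide_distrib)
          moreover have "(1 / \<eta>\<^sup>2) ^ Suc T = 1 / (\<eta>\<^sup>2 * (\<eta> ^ T)\<^sup>2)"
            by (simp only: power_one_over power_Suc sq) simp
          ultimately show ?thesis using \<eta> by (simp add: G_def)
        qed
        finally show "(\<Sum>s\<in>{T..<n}. ((1 / \<eta>) ^ Suc s)\<^sup>2) \<le> G" .
        have "(\<Sum>s\<in>{T..<n}. (norm (cB *v w s))\<^sup>2) \<le> (\<Sum>s<n. (norm (cB *v w s))\<^sup>2)"
          by (rule sum_mono2) auto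
        with J[of n] show "(\<Sum>s\<in>{T..<n}. (norm (cB *v w s))\<^sup>2) \<le> J" by linarith
      qed (use G0 in \<open>auto intro: sum_nonneg\<close>)
      finally show "(\<Sum>s\<in>{T..<n}. (1 / \<eta>) ^ Suc s * norm (cB *v w s))\<^sup>2 \<le> G * J" .
    qed
    have bound: "sm * (norm q)\<^sup>2 \<le> sm * e n + norm y * sqrt (G * J)" for n
    proof -
      have "sm * (norm q)\<^sup>2 = sm * e n + (\<Sum>s\<in>{T..<n}. sm * (- (y \<bullet> (N s *v w s))))"
        unfolding split[of n] by (simp add: right_diff_distrib sum_distrib_left sum_negf)
      also have "(\<Sum>s\<in>{T..<n}. sm * (- (y \<bullet> (N s *v w s))))
          \<le> (\<Sum>s\<in>{T..<n}. norm y * ((1 / \<eta>) ^ Suc s * norm (cB *v w s)))"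
        by (intro sum_mono order_trans[OF _ step] mult_left_mono sv) simp
      also have "\<dots> \<le> norm y * sqrt (G * J)"
        unfolding sum_distrib_left[symmetric] by (intro mult_left_mono CS) simp
      finally show ?thesis by simp
    qed
    have "(\<lambda>n. sm * e n + norm y * sqrt (G * J)) \<longlonglongrightarrow> sm * 0 + norm y * sqrt (G * J)"
      by (intro tendsto_intros e)
    then have "sm * (norm q)\<^sup>2 \<le> norm y * sqrt (G * J)"
      using bound by (intro LIMSEQ_le_const) auto
    then have "(sm * (norm q)\<^sup>2)\<^sup>2 \<le> (norm y * sqrt (G * J))\<^sup>2"
      by (rule power_mono) (simp add: sv)
    also have "\<dots> = (norm y)\<^sup>2 * G * J" using G0 J0 by (simp add: power_mult_distrib)
    finally show ?thesis by (simp add: J_def)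
  qed
  have lP0: "0 \<le> lP * (norm q)\<^sup>2"
  proof -
    have "0 \<le> axis undefined 1 \<bullet> (P *v axis undefined 1)"
      using opt by (simp add: optimal_cost_matrix_def sym_psd_def)
    also have "\<dots> \<le> lP"
      using quadratic_form_le_lambda_max[of P "axis undefined 1"] opt
      by (simp add: lP_def optimal_cost_matrix_def sym_psd_def norm_axis_1)
    finally show ?thesis by simp
  qed
  \<comment> \<open>The slack of the near-optimal inputs is removed by rescaling it with the
    positive factor \<open>(norm y)\<^sup>2 * G\<close>.\<close>
  have "(sm * (norm q)\<^sup>2)\<^sup>2 \<le> (norm y)\<^sup>2 * G * (lP * (norm q)\<^sup>2)"
  proof (rule field_le_epsilon)
    fix \<epsilon> :: real assume \<epsilon>: "\<epsilon> > 0"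
    have c: "(norm y)\<^sup>2 * G > 0" using y0 G0 by simp
    from main[of "\<epsilon> / ((norm y)\<^sup>2 * G)"] \<epsilon> c y0 G0
    show "(sm * (norm q)\<^sup>2)\<^sup>2 \<le> (norm y)\<^sup>2 * G * (lP * (norm q)\<^sup>2) + \<epsilon>"
      by (simp add: distrib_left)
  qed
  also have "\<dots> \<le> (sM * norm q)\<^sup>2 * G * (lP * (norm q)\<^sup>2)"
    using yq G0 lP0 by (intro mult_right_mono power_mono) auto
  also have "\<dots> = (sM\<^sup>2 * lP * G) * ((norm q)\<^sup>2)\<^sup>2"
    by (simp only: power_mult_distrib power2_eq_square[of "(norm q)\<^sup>2"] mult_ac)
  finally have "sm\<^sup>2 * ((norm q)\<^sup>2)\<^sup>2 \<le> (sM\<^sup>2 * lP * G) * ((norm q)\<^sup>2)\<^sup>2"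
    by (simp only: power_mult_distrib)
  then have "sm\<^sup>2 \<le> sM\<^sup>2 * lP * G"
    by (rule mult_right_le_imp_le) (use q0 in simp)
  then have "sm\<^sup>2 / G \<le> sM\<^sup>2 * lP" using G0 by (simp add: pos_divide_le_eq)
  then show ?thesis by (simp add: G_def sm_def sM_def lP_def)
qed

section \<open>The spectrum and the choice of the horizon\<close>

lemma spec_diagonalized:
  assumes "diagonalized_by A V"
  shows "spec A = range (\<lambda>i. (matrix_inv V ** complex_matrix A ** V) $ i $ i)"
proof -
  define l where "l i = (matrix_inv V ** complex_matrix A ** V) $ i $ i" for i
  note coord = diagonalized_by_coordinate[OF assms, folded l_def]
  note WV = diagonalized_by_inverse[OF assms]
  have "\<mu> \<in> range l" if \<mu>: "\<mu> \<in> spec A" for \<mu>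
  proof -
    obtain v where v: "v \<noteq> 0" "complex_matrix A *v v = \<mu> *s v"
      using \<mu> by (auto simp: spec_def eigenvalues_def)
    have "matrix_inv V *v v \<noteq> 0" using v(1) WV(2)[of v] by auto
    then obtain i where i: "(matrix_inv V *v v) $ i \<noteq> 0" by (auto simp: vec_eq_iff)
    have "\<mu> = l i" using coord[of v i] i by (simp add: v(2) vector_scalar_commute)
    then show ?thesis by simp
  qed
  moreover have "l i \<in> spec A" for i
  proof -
    let ?v = "V *v axis i 1"
    have "matrix_inv V *v (complex_matrix A *v ?v) = matrix_inv V *v (l i *s ?v)"
      unfolding vec_eq_iff by (simp add: coord WV vector_scalar_commute axis_def)
    then have "complex_matrix A *v ?v = l i *s ?v" by (metis WV(2))
    moreover have "?v \<noteq> 0" using WV(1)[of "axis i 1"] by (auto simp: axis_eq_0_iff)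
    ultimately show ?thesis unfolding spec_def eigenvalues_def by blast
  qed
  ultimately show ?thesis unfolding l_def[symmetric] by blast
qed

text \<open>\<open>ARG_MAX\<close> is a choice and needs an existing maximiser; the spectrum is
  finite and nonempty, being the set of diagonal entries.\<close>

lemma dominant_eigenvalue_in_spec:
  assumes "diagonalized_by A V"
  shows "dominant_eigenvalue A \<in> spec A"
proof -
  have fin: "finite (spec A)" and ne: "spec A \<noteq> {}"
    by (simp_all add: spec_diagonalized[OF assms])
  from fin ne have "Max (cmod ` spec A) \<in> cmod ` spec A" by (intro Max_in) auto
  then obtain \<mu> where \<mu>: "\<mu> \<in> spec A" "cmod \<mu> = Max (cmod ` spec A)" by auto
  have "\<not> cmod \<nu> > cmod \<mu>" if "\<nu> \<in> spec A" for \<nu>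
    using that fin by (simp add: \<mu>(2) not_less)
  then show ?thesis
    unfolding dominant_eigenvalue_def
    using arg_maxI[of "\<lambda>\<mu>. \<mu> \<in> spec A" \<mu> cmod "\<lambda>\<mu>. \<mu> \<in> spec A"] \<mu>(1) by blast
qed

theorem theorem1:
  fixes A Q Qhalf P :: "real^'n^'n"
    and B :: "real^'s^'n"
    and V :: "complex^'n^'n"
    and S :: "(real^'n) set"
    and \<eta> :: real
  assumes "invertible A"
    and "S \<subseteq> cart_basis" and "S \<noteq> {}"
    and "input_matrix S B"
    and "cmod (dominant_eigenvalue A) > 1"
    and "diagonalized_by A V"
    and "\<eta> \<in> {1<..cmod (dominant_eigenvalue A)}"
    and "sym_psd Q"
    and "is_psd_sqrt Qhalf Q" and "detectable A Qhalf"
    and "optimal_cost_matrix A B Q (mat 1) P"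
    and "riccati_equation A B Q (mat 1) P"
  shows "lambda_max P \<ge>
    1 / (cond V)\<^sup>2 * ((\<eta>\<^sup>2 - 1) / \<eta>\<^sup>2)
      * \<eta> powr (2 * (real (num_eigenvalues_ge A \<eta>) / real (card S) - 1))"
proof -
  note diag = assms(6)
  have \<eta>: "\<eta> > 1" "\<eta> \<le> cmod (dominant_eigenvalue A)" using assms(7) by auto
  define l where "l i = (matrix_inv V ** complex_matrix A ** V) $ i $ i" for i
  define k where "k = num_eigenvalues_ge A \<eta>"
  define m where "m = CARD('s)"
  \<comment> \<open>Once \<open>k > 0\<close> is known, this is the largest \<open>T\<close> with
    \<open>T * m < k\<close>, and \<open>k \<le> Suc T * m\<close> gives
    \<open>k / m - 1 \<le> T\<close>.\<close>
  define T where "T = (k - 1) div m"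
  have m: "m > 0" and cardS: "card S = m"
    using assms(4) zero_less_card_finite[where 'a = 's] by (simp_all only: m_def input_matrix_def)
  have spec: "spec A = range l" unfolding l_def by (rule spec_diagonalized[OF diag])
  \<comment> \<open>The dominant eigenvalue is counted by \<open>k\<close>, which rules out the
    truncated subtraction \<open>0 - 1\<close> in \<open>T\<close>.\<close>
  have "dominant_eigenvalue A \<in> {\<mu> \<in> spec A. \<eta> \<le> cmod \<mu>}"
    using dominant_eigenvalue_in_spec[OF diag] \<eta>(2) by simp
  then have "{\<mu> \<in> spec A. \<eta> \<le> cmod \<mu>} \<noteq> {}" by blast
  then have k: "k > 0" unfolding k_def num_eigenvalues_ge_def by (simp add: card_gt_0_iff spec)
  have "{\<mu> \<in> spec A. \<eta> \<le> cmod \<mu>} = l ` {i. \<eta> \<le> cmod (l i)}" by (auto simp: spec)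
  \<comment> \<open>\<open>k\<close> counts distinct eigenvalues, while several indices may share
    one.\<close>
  then have "k \<le> card {i. \<eta> \<le> cmod (l i)}"
    unfolding k_def num_eigenvalues_ge_def by (simp add: card_image_le)
  moreover have "T * m \<le> k - 1" by (simp add: T_def)
  ultimately have T: "T * m < card {i. \<eta> \<le> cmod (l i)}" using k by linarith
  define a b where "a = Min (singular_values V)" and "b = Max (singular_values V)"
  have main: "a\<^sup>2 * ((\<eta>\<^sup>2 - 1) * (\<eta> ^ T)\<^sup>2) \<le> b\<^sup>2 * lambda_max P"
    unfolding a_def b_def
    by (rule lambda_max_singular_value_bound[OF diag assms(10) assms(11) assms(9) assms(4) assms(2) \<eta>(1)])
      (use T in \<open>simp add: l_def m_def\<close>)
  have "V *v axis undefined 1 \<noteq> 0"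
    using diagonalized_by_inverse(1)[OF diag, of "axis undefined 1"] by (auto simp: axis_eq_0_iff)
  then have "b \<noteq> 0" using singular_value_bounds(1)[of V "axis undefined 1"] by (auto simp: b_def)
  then have le: "a\<^sup>2 / b\<^sup>2 * ((\<eta>\<^sup>2 - 1) * (\<eta> ^ T)\<^sup>2) \<le> lambda_max P"
    using main by (simp add: divide_le_eq mult.commute)
  have cond: "1 / (cond V)\<^sup>2 = a\<^sup>2 / b\<^sup>2"
    by (simp add: cond_def a_def b_def power_divide)
  \<comment> \<open>Two losses occur here: the factor \<open>1 / \<eta>\<^sup>2\<close> is at most
    1, and the exponent \<open>k / m - 1\<close> is rounded up to the integer
    \<open>T\<close>.\<close>
  have "(\<eta>\<^sup>2 - 1) / \<eta>\<^sup>2 * \<eta> powr (2 * (real k / real m - 1)) \<le> (\<eta>\<^sup>2 - 1) * (\<eta> ^ T)\<^sup>2"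
  proof (rule mult_mono)
    have \<eta>2: "\<eta>\<^sup>2 > 1" using \<eta> by simp
    then show "(\<eta>\<^sup>2 - 1) / \<eta>\<^sup>2 \<le> \<eta>\<^sup>2 - 1" "0 \<le> \<eta>\<^sup>2 - 1"
      using \<eta> by (auto simp: divide_le_eq)
    have "k - 1 < Suc T * m" unfolding T_def using m by (simp add: dividend_less_div_times)
    then have "k \<le> Suc T * m" by linarith
    then have "real k \<le> real (Suc T) * real m" by (metis of_nat_le_iff of_nat_mult)
    then have "real k / real m - 1 \<le> real T" using m by (simp add: divide_le_eq algebra_simps)
    then have "\<eta> powr (2 * (real k / real m - 1)) \<le> \<eta> powr (2 * real T)"
      using \<eta> by (intro powr_mono) auto
    also have "\<dots> = (\<eta> ^ T)\<^sup>2"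
      using \<eta> powr_realpow[of \<eta> "2 * T"] by (simp add: power_mult[symmetric] mult.commute)
    finally show "\<eta> powr (2 * (real k / real m - 1)) \<le> (\<eta> ^ T)\<^sup>2" .
  qed simp
  then have "a\<^sup>2 / b\<^sup>2 * ((\<eta>\<^sup>2 - 1) / \<eta>\<^sup>2 * \<eta> powr (2 * (real k / real m - 1)))
      \<le> a\<^sup>2 / b\<^sup>2 * ((\<eta>\<^sup>2 - 1) * (\<eta> ^ T)\<^sup>2)"
    by (rule mult_left_mono) simp
  also note le
  finally show ?thesis unfolding cond cardS k_def mult.assoc .
qed

end
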